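(* Let $A=\mathbb{F}_q[T]$ and $K=\mathbb{F}_q(T)$, and let $\phi$ be a rank $1$ Drinfeld $A$-module over $K$. Case 1: $q=2$. Then $\phi$ is isomorphic over $K$ to the Carlitz module, given by $\phi_T(x)=Tx+x^2$. For the Carlitz module, $({}^{\phi}K)_{\mathrm{tors}} = \mathbb{F}_2+\mathbb{F}_2\cdot T$, and this torsion submodule is isomorphic to $\mathbb{F}_2[T]/(T^2+T)$ as an $\mathbb{F}_2[T]$-module. Case 2: $q>2$. If $\phi_T(x)=Tx-(T+c)x^q$ for some $c\in\mathbb{F}_q$, then the torsion submodule $({}^{\phi}K)_{\mathrm{tors}}$ equals $\mathbb{F}_q\subset {}^{\phi}K$ and is isomorphic to $\mathbb{F}_q[T]/(T+c)$ as an $\mathbb{F}_q[T]$-module. If $\phi$ is not isomorphic over $K$ to such a Drinfeld module (for any $c\in\mathbb{F}_q$), then $({}^{\phi}K)_{\mathrm{tors}}=0$.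
   Context: A rank $1$ Drinfeld $\mathbb{F}_q[T]$-module over $K$ is an $\mathbb{F}_q$-algebra homomorphism $a\mapsto\phi_a$ from $\mathbb{F}_q[T]$ to the ring (under addition and composition) of $\mathbb{F}_q$-linear polynomials over $K$, determined by $\phi_T(x)=Tx+a_1x^q$ with $a_1\in K^{*}$. Two such modules $\phi,\psi$ are isomorphic over $K$ if there is $u\in K^{*}$ with $\phi_a(ux)=u\,\psi_a(x)$ for all $a\in A$. The module ${}^{\phi}K$ is the additive group of $K$ with the $A$-module structure $a\cdot\alpha=\phi_a(\alpha)$, and $({}^{\phi}K)_{\mathrm{tors}} = \{\alpha\in K : \phi_a(\alpha)=0 \text{ for some nonzero } a\in A\}$. *)

theory Defs
  imports
    "HOL-Library.Cardinality"
    "HOL-Computational_Algebra.Polynomial"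
    "HOL-Computational_Algebra.Fraction_Field"
    "HOL-Algebra.Module"
    "HOL-Algebra.QuotRing"
begin

text \<open>
  Throughout, the finite field \<open>F\<^sub>q\<close> is a type \<open>'a :: {field, finite}\<close> with \<open>q = CARD('a)\<close>;
  \<open>A = F\<^sub>q[T]\<close> is \<open>'a poly\<close>, with \<open>T = [:0, 1:]\<close>; and \<open>K = F\<^sub>q(T)\<close> is \<open>'a poly fract\<close>.
  Polynomials over \<open>K\<close> (in the variable \<open>x\<close>) have type \<open>'a poly fract poly\<close>.
\<close>

definition A_to_K :: "'a::field poly \<Rightarrow> 'a poly fract" where
  "A_to_K a = Fraction_Field.Fract a 1"

definition Fq_to_K :: "'a::field \<Rightarrow> 'a poly fract" where
  "Fq_to_K c = A_to_K [:c:]"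

definition T_K :: "'a::field poly fract" where
  "T_K = A_to_K [:0, 1:]"


subsection \<open>Drinfeld modules of rank 1\<close>

text \<open>The \<open>F\<^sub>q\<close>-linear polynomials are the \<open>K\<close>-linear combinations of the monomials
  \<open>x, x\<^sup>q, x^(q\<^sup>2), \<dots>\<close>.\<close>

definition Fq_linear_poly :: "'a::{field,finite} poly fract poly \<Rightarrow> bool" where
  "Fq_linear_poly p \<longleftrightarrow>
     (\<forall>n. Polynomial.coeff p n \<noteq> 0 \<longrightarrow> (\<exists>i. n = CARD('a) ^ i))"

text \<open>The polynomial \<open>T x + a x\<^sup>q\<close>.\<close>

definition T_poly :: "'a::{field,finite} poly fract \<Rightarrow> 'a poly fract poly" where
  "T_poly a = Polynomial.monom T_K 1 + Polynomial.monom a CARD('a)"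

text \<open>Multiplication in the ring of \<open>F\<^sub>q\<close>-linear polynomials is composition, its unit is \<open>x\<close>,
  and its \<open>F\<^sub>q\<close>-algebra structure sends \<open>c\<close> to \<open>c x\<close>.\<close>

definition drinfeld_module_rank1 ::
    "('a::{field,finite} poly \<Rightarrow> 'a poly fract poly) \<Rightarrow> bool" where
  "drinfeld_module_rank1 \<phi> \<longleftrightarrow>
     (\<forall>a. Fq_linear_poly (\<phi> a)) \<and>
     (\<forall>a b. \<phi> (a + b) = \<phi> a + \<phi> b) \<and>
     (\<forall>a b. \<phi> (a * b) = pcompose (\<phi> a) (\<phi> b)) \<and>
     (\<forall>c. \<phi> [:c:] = Polynomial.monom (Fq_to_K c) 1) \<and>
     (\<exists>a1. a1 \<noteq> 0 \<and> \<phi> [:0, 1:] = T_poly a1)"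

definition drinfeld_isomorphic ::
    "('a::{field,finite} poly \<Rightarrow> 'a poly fract poly) \<Rightarrow>
     ('a poly \<Rightarrow> 'a poly fract poly) \<Rightarrow> bool" where
  "drinfeld_isomorphic \<phi> \<psi> \<longleftrightarrow>
     (\<exists>u. u \<noteq> 0 \<and>
       (\<forall>a. pcompose (\<phi> a) (Polynomial.monom u 1) = Polynomial.smult u (\<psi> a)))"

definition carlitz_module ::
    "('a::{field,finite} poly \<Rightarrow> 'a poly fract poly) \<Rightarrow> bool" where
  "carlitz_module \<psi> \<longleftrightarrow> drinfeld_module_rank1 \<psi> \<and> \<psi> [:0, 1:] = T_poly 1"


subsection \<open>Modules over the polynomial ring\<close>

definition A_ring :: "'a::field poly ring" where
  "A_ring = \<lparr>carrier = UNIV, mult = (*), one = 1, zero = 0, add = (+)\<rparr>"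

text \<open>The record type of modules extends that of rings, so the fields \<open>mult\<close> and \<open>one\<close> have to be
  filled in; they play no role in the module structure.\<close>

definition drinfeld_action ::
    "('a::{field,finite} poly \<Rightarrow> 'a poly fract poly) \<Rightarrow>
     ('a poly, 'a poly fract) module" where
  "drinfeld_action \<phi> =
     \<lparr>carrier = UNIV, mult = (*), one = 1, zero = 0, add = (+),
      smult = (\<lambda>a \<alpha>. poly (\<phi> a) \<alpha>)\<rparr>"

definition torsion ::
    "('a::{field,finite} poly \<Rightarrow> 'a poly fract poly) \<Rightarrow> 'a poly fract set" where
  "torsion \<phi> = {\<alpha>. \<exists>a. a \<noteq> 0 \<and> poly (\<phi> a) \<alpha> = 0}"

definition torsion_module ::
    "('a::{field,finite} poly \<Rightarrow> 'a poly fract poly) \<Rightarrow>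
     ('a poly, 'a poly fract) module" where
  "torsion_module \<phi> = (drinfeld_action \<phi>)\<lparr>carrier := torsion \<phi>\<rparr>"

text \<open>The quotient \<open>R/I\<close> as an \<open>R\<close>-module.\<close>

definition quotient_module :: "'b ring \<Rightarrow> 'b set \<Rightarrow> ('b, 'b set) module" where
  "quotient_module R I =
     \<lparr>carrier = carrier (R Quot I), mult = mult (R Quot I), one = one (R Quot I),
      zero = zero (R Quot I), add = add (R Quot I),
      smult = (\<lambda>a X. (I +>\<^bsub>R\<^esub> a) \<otimes>\<^bsub>R Quot I\<^esub> X)\<rparr>"

definition module_isomorphic ::
    "'b ring \<Rightarrow> ('b, 'c) module \<Rightarrow> ('b, 'd) module \<Rightarrow> bool" where
  "module_isomorphic R M N \<longleftrightarrow>
     Module.module R M \<and> Module.module R N \<and>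
     (\<exists>h. bij_betw h (carrier M) (carrier N) \<and>
       (\<forall>x\<in>carrier M. \<forall>y\<in>carrier M. h (x \<oplus>\<^bsub>M\<^esub> y) = h x \<oplus>\<^bsub>N\<^esub> h y) \<and>
       (\<forall>r\<in>carrier R. \<forall>x\<in>carrier M. h (r \<odot>\<^bsub>M\<^esub> x) = r \<odot>\<^bsub>N\<^esub> h x))"

end

theory Submission
  imports Defs "HOL-Computational_Algebra.Polynomial_Factorial"
begin

text \<open>
  Let \<open>\<phi>\<^sub>T(x) = T x + a x\<^sup>q\<close> and let \<open>\<alpha> \<noteq> 0\<close> be a torsion point in \<open>K\<close>. Rescaling by \<open>\<alpha>\<close> moves \<open>\<alpha>\<close> to \<open>1\<close>
  and turns \<open>a\<close> into \<open>x = a \<alpha>^(q-1)\<close>, so everything is encoded in the orbit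
  \<open>\<beta> 0 = 1, \<beta> (n+1) = T \<beta> n + x (\<beta> n)\<^sup>q\<close>: torsion means that the \<open>\<beta> n\<close> are linearly dependent over
  \<open>F\<^sub>q\<close> (\<open>drinfeld_action_orbit\<close>). This dependence is exploited at the finite places and at infinity.

  At the finite places: seen as a polynomial in an indeterminate \<open>x\<close> over \<open>A\<close>, the element \<open>\<beta> n\<close> is
  monic, of a degree that strictly increases with \<open>n\<close>. A dependence relation is therefore an equation
  of integrality for \<open>x\<close> over \<open>A\<close>, and \<open>x \<in> A\<close> because \<open>A\<close> is integrally closed
  (\<open>integral_imp_polynomial\<close>, \<open>torsion_orbit_relation\<close>).

  At infinity: now the \<open>\<beta> n\<close> are polynomials in \<open>T\<close>. As soon as the term \<open>x (\<beta> n)\<^sup>q\<close> has larger degree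
  than \<open>T \<beta> n\<close> for one \<open>n\<close>, it dominates for ever, the degrees increase strictly
  (\<open>degree_growth\<close>), and the \<open>\<beta> n\<close> are independent. This bounds the degree of \<open>x\<close> by \<open>1\<close>, and for \<open>q > 2\<close>
  it forces \<open>\<beta> 1 = T + x\<close> to be constant, so that \<open>x = -(T + c)\<close> (\<open>torsion_coefficient\<close>).

  For \<open>q > 2\<close> a nonzero torsion point \<open>\<alpha>\<close> thus provides, by rescaling, an isomorphism from \<open>\<phi>\<close> to a module
  with \<open>a = -(T + c)\<close>. If \<open>a = -(T + c)\<close> from the start, then \<open>\<alpha>^(q-1) = (T + d)/(T + c)\<close> for some \<open>d\<close>;
  since \<open>q - 1 \<ge> 2\<close>, the order of vanishing at \<open>-d\<close> yields \<open>c = d\<close>, hence \<open>\<alpha>\<^sup>q = \<alpha>\<close> and \<open>\<alpha> \<in> F\<^sub>q\<close>.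
  For \<open>q = 2\<close> rescaling by \<open>1/a\<close> leads to the Carlitz module, where \<open>x = \<alpha>\<close>, so that \<open>\<alpha>\<close> is a polynomial of
  degree at most \<open>1\<close>. In both cases the action on \<open>1\<close> has a closed form in terms of the values
  of \<open>f\<close> at points of \<open>F\<^sub>q\<close>; it shows that \<open>1\<close> generates the torsion and what annihilates it, hence the structure of
  the torsion as a quotient of \<open>A\<close> (\<open>cyclic_torsion_isomorphic_quotient\<close>).
\<close>

section \<open>The finite field and its rational function field\<close>

lemma K_embeddings:
  "A_to_K f = to_fract f" "Fq_to_K c = to_fract [:c:]" "T_K = to_fract [:0, 1:]"
  by (simp_all add: A_to_K_def Fq_to_K_def T_K_def to_fract_def)

lemma to_fract_power: "to_fract (x ^ n) = to_fract x ^ n"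
  by (induction n) auto

lemma one_less_CARD_field: "1 < CARD('a::{field,finite})"
proof -
  have "card {0, 1 :: 'a} \<le> CARD('a)" by (intro card_mono) auto
  then show ?thesis by simp
qed

text \<open>
  Multiplication by \<open>x \<noteq> 0\<close> permutes the nonzero elements and so preserves their product.
\<close>
lemma power_CARD_eq_self:
  fixes x :: "'a::{field,finite}"
  shows "x ^ CARD('a) = x"
proof (cases "x = 0")
  case False
  have "bij_betw ((*) x) (- {0}) (- {0})"
    using False by (intro bij_betwI[where g = "\<lambda>y. y / x"]) auto
  then have "(\<Prod>y\<in>- {0}. x * y) = \<Prod>(- {0})"
    by (rule prod.reindex_bij_betw)
  then have "x ^ card (- {0 :: 'a}) = 1"
    by (simp add: prod.distrib)
  moreover have "CARD('a) = Suc (card (- {0 :: 'a}))"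
    using one_less_CARD_field[where 'a = 'a] by (simp add: Compl_eq_Diff_UNIV)
  ultimately show ?thesis by simp
next
  case True
  then show ?thesis using one_less_CARD_field[where 'a = 'a] by simp
qed

text \<open>
  The \<open>q\<close> elements of \<open>F\<^sub>q\<close> are already as many roots of \<open>x\<^sup>q - x\<close> as its degree permits.
\<close>
lemma fixed_by_power_CARD:
  fixes x :: "'a::{field,finite} poly fract"
  assumes "x ^ CARD('a) = x"
  shows "x \<in> range Fq_to_K"
proof -
  let ?p = "Polynomial.monom 1 CARD('a) - Polynomial.monom 1 1 :: 'a poly fract poly"
  have q: "1 < CARD('a)" by (rule one_less_CARD_field)
  have "Polynomial.coeff ?p CARD('a) = 1" using q by simp
  then have nz: "?p \<noteq> 0" by (metis coeff_0 zero_neq_one)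
  have deg: "degree ?p \<le> CARD('a)" using q by (intro degree_diff_le) (auto simp: degree_monom_eq)
  have fin: "finite {x. poly ?p x = 0}" using nz by (rule poly_roots_finite)
  have inj: "inj (Fq_to_K :: 'a \<Rightarrow> _)" by (auto simp: inj_def K_embeddings)
  have sub: "range Fq_to_K \<subseteq> {x. poly ?p x = 0}"
    by (auto simp: K_embeddings poly_monom power_CARD_eq_self poly_const_pow simp flip: to_fract_power)
  have "card {x. poly ?p x = 0} \<le> card (range (Fq_to_K :: 'a \<Rightarrow> _))"
    using card_poly_roots_bound[OF nz] deg by (simp add: card_image[OF inj])
  then have "range Fq_to_K = {x. poly ?p x = 0}"
    using fin sub card_seteq by blast
  then show ?thesis using assms by (simp add: poly_monom)
qed

section \<open>Integrality over the polynomial ring\<close>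

text \<open>
  This is integral closedness of \<open>F[T]\<close>, for equations whose leading coefficient is a nonzero
  constant. The argument uses the ideal of denominators \<open>{w. w x \<in> A}\<close> and its
  generator \<open>s\<close>, a nonzero element of least degree; let \<open>p = s x\<close>. Multiplying the equation by
  \<open>s^(N-1)\<close>, where \<open>N\<close> is its degree, shows that \<open>p^(N-1)\<close> is a denominator. If \<open>p^(k+1)\<close> is
  one, then \<open>p^(k+1) = s w\<close> for some \<open>w\<close>, so that \<open>p^k x = w\<close> and \<open>p^k\<close> is one too.
  Descending to \<open>p^0 = 1\<close> gives \<open>x \<in> A\<close>.
\<close>
lemma integral_imp_polynomial:
  fixes x :: "'a::field poly fract" and P :: "'a poly poly"
  assumes root: "poly (fract_poly P) x = 0" and lead: "lead_coeff P = [:c:]" and c: "c \<noteq> 0"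
  shows "x \<in> range to_fract"
proof -
  define D where "D s \<longleftrightarrow> s \<noteq> 0 \<and> to_fract s * x \<in> range to_fract" for s
  obtain p0 s0 where "x = to_fract p0 / to_fract s0" "s0 \<noteq> 0"
    by (cases x) (auto simp: Fract_conv_to_fract)
  then have "D s0" by (auto simp: D_def)
  then obtain s where s: "D s" and least: "\<And>s'. D s' \<Longrightarrow> degree s \<le> degree s'"
    using ex_has_least_nat[of D s0 degree] by blast
  then obtain p where p: "to_fract s * x = to_fract p" and s0: "s \<noteq> 0"
    by (auto simp: D_def)
  have dvd: "s dvd w" if w: "to_fract w * x \<in> range to_fract" for w
  proof (rule ccontr)
    assume "\<not> s dvd w"
    then have nz: "w mod s \<noteq> 0" by (simp add: mod_eq_0_iff_dvd)
    have remainder: "to_fract (w mod s) = to_fract w - to_fract s * to_fract (w div s)"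
      by (simp add: minus_mult_div_eq_mod flip: to_fract_mult to_fract_diff)
    have "to_fract (w mod s) * x = to_fract w * x - to_fract (w div s) * (to_fract s * x)"
      unfolding remainder by (simp add: algebra_simps)
    also have "\<dots> \<in> range to_fract"
      using w by (auto simp: p simp flip: to_fract_mult to_fract_diff)
    finally have "D (w mod s)" using nz by (simp add: D_def)
    then show False using least degree_mod_less'[OF s0 nz] by fastforce
  qed
  have descend: "x \<in> range to_fract" if "to_fract (p ^ k) * x \<in> range to_fract" for k
    using that
  proof (induction k)
    case (Suc k)
    obtain w where w: "p ^ Suc k = s * w" using dvd[OF Suc.prems] by blast
    have "to_fract s * (to_fract (p ^ k) * x) = to_fract (p ^ Suc k)"
      by (simp add: p[symmetric] algebra_simps)
    also have "\<dots> = to_fract s * to_fract w" by (simp only: w to_fract_mult)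
    finally have "to_fract (p ^ k) * x = to_fract w" using s0 by simp
    then show ?case using Suc.IH by blast
  qed simp
  (* The degree must be positive because the equation is multiplied by s^(degree P - 1). *)
  have deg: "degree P > 0"
  proof (rule ccontr)
    assume "\<not> degree P > 0"
    then have "P = [:[:c:]:]" using lead by (metis degree_eq_zeroE gr0I lead_coeff_pCons(2))
    then show False using root c by (simp add: map_poly_pCons)
  qed
  then obtain n where n: "degree P = Suc n" using gr0_implies_Suc by blast
  have "0 = to_fract s ^ n * poly (fract_poly P) x" using root by simp
  also have "\<dots> = to_fract s ^ n * (\<Sum>i\<le>Suc n. to_fract (Polynomial.coeff P i) * x ^ i)"
    by (simp add: poly_altdef coeff_map_poly degree_map_poly n)
  also have "\<dots> = to_fract ([:c:] * p ^ n) * x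
      + to_fract s ^ n * (\<Sum>i\<le>n. to_fract (Polynomial.coeff P i) * x ^ i)"
    using lead by (simp add: n to_fract_power p[symmetric] algebra_simps power_mult_distrib
        del: mult_pCons_left)
  also have "to_fract s ^ n * (\<Sum>i\<le>n. to_fract (Polynomial.coeff P i) * x ^ i)
      = (\<Sum>i\<le>n. to_fract (Polynomial.coeff P i * s ^ (n - i) * p ^ i))"
    unfolding sum_distrib_left
  proof (rule sum.cong[OF refl])
    fix i assume "i \<in> {..n}"
    then have "to_fract s ^ n = to_fract s ^ (n - i) * to_fract s ^ i"
      by (simp flip: power_add)
    then show "to_fract s ^ n * (to_fract (Polynomial.coeff P i) * x ^ i)
        = to_fract (Polynomial.coeff P i * s ^ (n - i) * p ^ i)"
      by (simp add: to_fract_power p[symmetric] power_mult_distrib)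
  qed
  finally have top: "to_fract ([:c:] * p ^ n) * x
      = to_fract (- (\<Sum>i\<le>n. Polynomial.coeff P i * s ^ (n - i) * p ^ i))"
    by (simp add: eq_neg_iff_add_eq_0)
  have "to_fract [:inverse c:] * (to_fract ([:c:] * p ^ n) * x) \<in> range to_fract"
    unfolding top by (metis rangeI to_fract_mult)
  also have "to_fract [:inverse c:] * (to_fract ([:c:] * p ^ n) * x)
      = to_fract ([:inverse c:] * [:c:] * p ^ n) * x"
    by (simp only: to_fract_mult mult_ac)
  also have "[:inverse c:] * [:c:] = 1" using c by (simp add: one_pCons)
  finally show ?thesis using descend by simp
qed

section \<open>Growth of degrees along orbits\<close>

lemma lead_coeff_sum_increasing_degree:
  fixes g :: "nat \<Rightarrow> 'b::idom poly"
  assumes mono: "strict_mono (\<lambda>n. degree (g n))" and "g N \<noteq> 0" "c N \<noteq> 0"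
  shows "lead_coeff (\<Sum>i\<le>N. Polynomial.smult (c i) (g i)) = c N * lead_coeff (g N)"
proof -
  let ?S = "\<Sum>i\<le>N. Polynomial.smult (c i) (g i)"
  have small: "Polynomial.coeff (g i) k = 0" if "i < N" "degree (g N) \<le> k" for i k
    using strict_monoD[OF mono that(1)] that(2) by (intro coeff_eq_0) simp
  have top: "Polynomial.coeff ?S k = c N * Polynomial.coeff (g N) k" if "degree (g N) \<le> k" for k
    using that small by (simp add: coeff_sum flip: lessThan_Suc_atMost)
  have "degree ?S = degree (g N)"
  proof (rule antisym)
    show "degree ?S \<le> degree (g N)"
      by (rule degree_le) (auto simp: top coeff_eq_0)
    show "degree (g N) \<le> degree ?S"
      using assms by (intro le_degree) (simp add: top)
  qed
  then show ?thesis by (simp add: top)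
qed

text \<open>
  The orbit of \<open>1\<close> under \<open>y \<mapsto> t y + b y\<^sup>q\<close>. The ring is left arbitrary because the same recursion is
  read in \<open>K\<close>, in \<open>A\<close>, and in \<open>A[X]\<close> with \<open>b = X\<close>.
\<close>
primrec twisted_orbit :: "nat \<Rightarrow> 'b::comm_ring_1 \<Rightarrow> 'b \<Rightarrow> nat \<Rightarrow> 'b" where
  "twisted_orbit q t b 0 = 1"
| "twisted_orbit q t b (Suc n) = t * twisted_orbit q t b n + b * twisted_orbit q t b n ^ q"

text \<open>
  Once \<open>b (g n)\<^sup>q\<close> dominates \<open>t (g n)\<close> in degree, the degree of \<open>g\<close> increases, and by \<open>q \<ge> 1\<close> the
  dominance persists. The starting index \<open>k\<close> is a parameter since over \<open>F\<^sub>q[T]\<close> the dominance may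
  set in only at \<open>n = 1\<close>.
\<close>
lemma degree_growth:
  fixes g :: "nat \<Rightarrow> 'b::idom poly"
  assumes rec: "\<And>n. n \<ge> k \<Longrightarrow> g (Suc n) = t * g n + b * g n ^ q"
    and q: "0 < q" and b: "b \<noteq> 0" and k: "g k \<noteq> 0"
    and dom: "degree t + degree (g k) < degree b + q * degree (g k)"
    and n: "n \<ge> k"
  shows "g n \<noteq> 0" "degree (g n) < degree (g (Suc n))"
    "lead_coeff (g (Suc n)) = lead_coeff b * lead_coeff (g n) ^ q"
proof -
  have grow: "degree (g (Suc m)) = degree b + q * degree (g m)"
    "lead_coeff (g (Suc m)) = lead_coeff b * lead_coeff (g m) ^ q"
    if "m \<ge> k" "g m \<noteq> 0" "degree t + degree (g m) < degree b + q * degree (g m)" for m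
  proof -
    have deg: "degree (b * g m ^ q) = degree b + q * degree (g m)"
      using b that(2) by (simp add: degree_mult_eq degree_power_eq)
    have less: "degree (t * g m) < degree (b * g m ^ q)"
      using degree_mult_le[of t "g m"] that(3) deg by simp
    show "degree (g (Suc m)) = degree b + q * degree (g m)"
      using degree_add_eq_right[OF less] that(1) deg by (simp add: rec)
    show "lead_coeff (g (Suc m)) = lead_coeff b * lead_coeff (g m) ^ q"
      using lead_coeff_add_le[OF less] that(1) by (simp add: rec lead_coeff_mult lead_coeff_power)
  qed
  have inv: "g n \<noteq> 0 \<and> degree t + degree (g n) < degree b + q * degree (g n)"
    using n
  proof (induction n rule: dec_induct)
    case base
    then show ?case using k dom by simp
  next
    case (step m)
    let ?d = "degree (g m)" and ?d' = "degree (g (Suc m))"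
    from step have d': "?d' = degree b + q * ?d"
      and lc: "lead_coeff (g (Suc m)) = lead_coeff b * lead_coeff (g m) ^ q"
      using grow by simp_all
    from lc have "lead_coeff (g (Suc m)) \<noteq> 0" using b step.IH by simp
    then have nz: "g (Suc m) \<noteq> 0" by (metis leading_coeff_0_iff)
    obtain r where r: "q = Suc r" using q gr0_implies_Suc by blast
    have "?d \<le> ?d'" using d' step.IH by simp
    then have "r * ?d \<le> r * ?d'" by simp
    moreover have "degree t < degree b + r * ?d" using step.IH r by simp
    ultimately have "degree t < degree b + r * ?d'" by linarith
    then have "degree t + ?d' < degree b + q * ?d'" using r by simp
    then show ?case using nz by blast
  qed
  then show "g n \<noteq> 0" by blast
  show "degree (g n) < degree (g (Suc n))" using grow(1)[OF n] inv by simp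
  show "lead_coeff (g (Suc n)) = lead_coeff b * lead_coeff (g n) ^ q" using grow(2)[OF n] inv by simp
qed

section \<open>The action of A through a Drinfeld module\<close>

lemma drinfeld_zero:
  assumes "drinfeld_module_rank1 \<phi>"
  shows "\<phi> 0 = 0" "poly (\<phi> f) 0 = 0"
proof -
  have "\<phi> [:0:] = Polynomial.monom (Fq_to_K 0) 1"
    using assms unfolding drinfeld_module_rank1_def by blast
  then show *: "\<phi> 0 = 0" by (simp add: K_embeddings)
  have "poly (\<phi> (f * 0)) 0 = poly (\<phi> f) (poly (\<phi> 0) 0)"
    using assms unfolding drinfeld_module_rank1_def by (metis poly_pcompose)
  then show "poly (\<phi> f) 0 = 0" by (simp add: *)
qed

lemma drinfeld_action_rules:
  assumes "drinfeld_module_rank1 \<phi>"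
  shows "poly (\<phi> (f + g)) \<alpha> = poly (\<phi> f) \<alpha> + poly (\<phi> g) \<alpha>"
    "poly (\<phi> (f * g)) \<alpha> = poly (\<phi> f) (poly (\<phi> g) \<alpha>)"
    "poly (\<phi> [:c:]) \<alpha> = to_fract [:c:] * \<alpha>"
  using assms unfolding drinfeld_module_rank1_def
  by (simp_all add: poly_pcompose poly_monom K_embeddings)

lemma drinfeld_action_pCons:
  fixes \<phi> :: "'a::{field,finite} poly \<Rightarrow> _"
  assumes D: "drinfeld_module_rank1 \<phi>" and T: "\<phi> [:0, 1:] = T_poly a"
  shows "poly (\<phi> (pCons c f)) \<alpha> = to_fract [:c:] * \<alpha>
    + (T_K * poly (\<phi> f) \<alpha> + a * poly (\<phi> f) \<alpha> ^ CARD('a))"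
proof -
  have "pCons c f = [:c:] + [:0, 1:] * f" by simp
  then show ?thesis
    by (simp only: drinfeld_action_rules[OF D] T) (simp add: T_poly_def poly_monom)
qed

lemma T_poly_inject: "T_poly a = T_poly b \<longleftrightarrow> a = b"
  for a b :: "'a::{field,finite} poly fract"
proof
  assume "T_poly a = T_poly b"
  then have "Polynomial.coeff (T_poly a) CARD('a) = Polynomial.coeff (T_poly b) CARD('a)" by simp
  then show "a = b" using one_less_CARD_field[where 'a = 'a] by (simp add: T_poly_def)
qed simp

lemma drinfeld_coefficient_nonzero:
  assumes "drinfeld_module_rank1 \<phi>" "\<phi> [:0, 1:] = T_poly a"
  shows "a \<noteq> 0"
  using assms unfolding drinfeld_module_rank1_def by (auto simp: T_poly_inject)

text \<open>
  The factor \<open>\<alpha>^(q-1)\<close> comes from \<open>a (\<alpha> y)\<^sup>q = \<alpha> (a \<alpha>^(q-1)) y\<^sup>q\<close>: conjugation by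
  multiplication with \<open>\<alpha>\<close> moves the orbit of \<open>\<alpha>\<close> to the orbit of \<open>1\<close>.
\<close>
lemma drinfeld_action_orbit:
  fixes \<phi> :: "'a::{field,finite} poly \<Rightarrow> _"
  assumes D: "drinfeld_module_rank1 \<phi>" and T: "\<phi> [:0, 1:] = T_poly a"
  shows "poly (\<phi> f) \<alpha> = \<alpha> * (\<Sum>i\<le>degree f. to_fract [:Polynomial.coeff f i:]
    * twisted_orbit CARD('a) T_K (a * \<alpha> ^ (CARD('a) - 1)) i)"
proof -
  let ?\<beta> = "twisted_orbit CARD('a) T_K (a * \<alpha> ^ (CARD('a) - 1))"
  have q: "\<alpha> ^ CARD('a) = \<alpha> * \<alpha> ^ (CARD('a) - 1)"
    by (simp add: power_eq_if)
  have mono: "poly (\<phi> (Polynomial.monom 1 n)) \<alpha> = \<alpha> * ?\<beta> n" for n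
  proof (induction n)
    case 0
    then show ?case
      using drinfeld_action_rules(3)[OF D, of 1] by (simp add: monom_0 flip: one_pCons)
  next
    case (Suc n)
    have "poly (\<phi> (Polynomial.monom 1 (Suc n))) \<alpha>
        = T_K * (\<alpha> * ?\<beta> n) + a * (\<alpha> * ?\<beta> n) ^ CARD('a)"
      by (simp add: monom_Suc drinfeld_action_pCons[OF D T] Suc)
    also have "\<dots> = \<alpha> * ?\<beta> (Suc n)"
      by (simp add: power_mult_distrib q algebra_simps)
    finally show ?case .
  qed
  have additive: "poly (\<phi> (\<Sum>i\<le>n. h i)) \<alpha> = (\<Sum>i\<le>n. poly (\<phi> (h i)) \<alpha>)" for h and n :: nat
    by (induction n) (simp_all add: drinfeld_action_rules[OF D])
  have "poly (\<phi> f) \<alpha> = poly (\<phi> (\<Sum>i\<le>degree f. [:Polynomial.coeff f i:] * Polynomial.monom 1 i)) \<alpha>"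
    by (simp add: smult_monom poly_as_sum_of_monoms)
  also have "\<dots> = (\<Sum>i\<le>degree f. to_fract [:Polynomial.coeff f i:] * (\<alpha> * ?\<beta> i))"
    unfolding additive by (simp only: drinfeld_action_rules[OF D] mono)
  finally show ?thesis by (simp add: sum_distrib_left mult_ac)
qed

section \<open>Torsion points and the coefficient of a rank one module\<close>

lemma to_fract_twisted_orbit:
  "to_fract (twisted_orbit q t b n) = twisted_orbit q (to_fract t) (to_fract b) n"
  by (induction n) (simp_all add: to_fract_power)

lemma fract_poly_power: "fract_poly (p ^ n) = fract_poly p ^ n"
  by (induction n) auto

lemma fract_poly_sum: "fract_poly (sum f A) = (\<Sum>i\<in>A. fract_poly (f i))"
  by (induction A rule: infinite_finite_induct) auto

lemma poly_fract_poly_twisted_orbit: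
  "poly (fract_poly (twisted_orbit q [:t:] [:0, 1:] n)) x = twisted_orbit q (to_fract t) x n"
  by (induction n) (simp_all add: fract_poly_power map_poly_pCons algebra_simps)

text \<open>
  Integrality of the rescaled coefficient: with an indeterminate in its place the orbit consists of monic
  polynomials of increasing degrees, so a relation over \<open>F\<^sub>q\<close> is, up to a constant, a monic equation
  over \<open>A\<close>. Being a polynomial, the coefficient then lets the relation itself be read in \<open>A\<close>.
\<close>
lemma torsion_orbit_relation:
  fixes \<phi> :: "'a::{field,finite} poly \<Rightarrow> _"
  assumes D: "drinfeld_module_rank1 \<phi>" and T: "\<phi> [:0, 1:] = T_poly a"
    and \<alpha>: "\<alpha> \<in> torsion \<phi>" "\<alpha> \<noteq> 0"
  obtains b f where "a * \<alpha> ^ (CARD('a) - 1) = to_fract b" "f \<noteq> 0"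
    "(\<Sum>i\<le>degree f. Polynomial.smult (Polynomial.coeff f i)
      (twisted_orbit CARD('a) [:0, 1:] b i)) = 0"
proof -
  let ?q = "CARD('a)"
  define x where "x = a * \<alpha> ^ (?q - 1)"
  obtain f where f: "f \<noteq> 0" "poly (\<phi> f) \<alpha> = 0" using \<alpha>(1) by (auto simp: torsion_def)
  have rel: "(\<Sum>i\<le>degree f. to_fract [:Polynomial.coeff f i:] * twisted_orbit ?q T_K x i) = 0"
    using f(2) \<alpha>(2) by (simp add: drinfeld_action_orbit[OF D T] x_def)
  let ?B = "twisted_orbit ?q [:[:0, 1:]:] [:0, 1:] :: nat \<Rightarrow> 'a poly poly"
  let ?P = "\<Sum>i\<le>degree f. Polynomial.smult [:Polynomial.coeff f i:] (?B i)"
  have root: "poly (fract_poly ?P) x = 0"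
    using rel by (simp add: fract_poly_sum poly_sum poly_fract_poly_twisted_orbit K_embeddings)
  note growth = degree_growth[of 0 ?B "[:[:0, 1:]:]" "[:0, 1:]" ?q, simplified]
  have mono: "strict_mono (\<lambda>n. degree (?B n))" and nz: "?B n \<noteq> 0" for n
    using growth by (simp_all add: strict_mono_Suc_iff)
  have monic: "lead_coeff (?B n) = 1" for n
    using growth(3) by (induction n) simp_all
  have "lead_coeff ?P = [:Polynomial.coeff f (degree f):] * lead_coeff (?B (degree f))"
    using f(1) by (intro lead_coeff_sum_increasing_degree[OF mono nz]) simp
  then have "lead_coeff ?P = [:lead_coeff f:]" unfolding monic by simp
  then have "x \<in> range to_fract"
    using f(1) by (intro integral_imp_polynomial[OF root]) auto
  then obtain b where b: "x = to_fract b" by blast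
  have smult_eq: "Polynomial.smult c p = [:c:] * p" for c :: 'a and p by simp
  have "to_fract (\<Sum>i\<le>degree f. Polynomial.smult (Polynomial.coeff f i)
      (twisted_orbit ?q [:0, 1:] b i)) = to_fract 0"
    unfolding smult_eq
    using rel by (simp add: K_embeddings b to_fract_twisted_orbit del: mult_pCons_left)
  then have "(\<Sum>i\<le>degree f. Polynomial.smult (Polynomial.coeff f i)
      (twisted_orbit ?q [:0, 1:] b i)) = 0"
    by (simp only: to_fract_eq_iff)
  with b f(1) show thesis unfolding x_def by (rule that)
qed

text \<open>
  By \<open>degree_growth\<close> a dependent orbit contains no element \<open>y\<close> for which \<open>b y\<^sup>q\<close> dominates \<open>T y\<close>
  in degree, provided that the degrees increase up to \<open>y\<close>. At \<open>y = 1\<close> this excludes \<open>degree b > 1\<close>. At \<open>y = T + b\<close>, of degree \<open>m\<close>, domination means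
  \<open>1 + m < degree b + q m\<close>, which for \<open>q \<ge> 3\<close> holds whenever \<open>m > 0\<close>.
\<close>
lemma torsion_coefficient:
  fixes \<phi> :: "'a::{field,finite} poly \<Rightarrow> _"
  assumes D: "drinfeld_module_rank1 \<phi>" and T: "\<phi> [:0, 1:] = T_poly a"
    and \<alpha>: "\<alpha> \<in> torsion \<phi>" "\<alpha> \<noteq> 0"
  obtains b where "a * \<alpha> ^ (CARD('a) - 1) = to_fract b" "degree b \<le> 1"
    "CARD('a) > 2 \<Longrightarrow> degree ([:0, 1:] + b) = 0"
proof -
  let ?q = "CARD('a)"
  obtain b f where b: "a * \<alpha> ^ (?q - 1) = to_fract b" and f: "f \<noteq> 0"
    and rel: "(\<Sum>i\<le>degree f. Polynomial.smult (Polynomial.coeff f i)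
      (twisted_orbit ?q [:0, 1:] b i)) = 0"
    using torsion_orbit_relation[OF D T \<alpha>] by blast
  let ?g = "twisted_orbit ?q [:0, 1:] b"
  have q: "2 \<le> ?q" using one_less_CARD_field[where 'a = 'a] by simp
  have "to_fract b \<noteq> 0"
    using drinfeld_coefficient_nonzero[OF D T] \<alpha>(2) by (simp flip: b)
  then have b0: "b \<noteq> 0" by simp
  have no_growth: False if "\<And>n. ?g n \<noteq> 0" "\<And>n. degree (?g n) < degree (?g (Suc n))"
  proof -
    have "lead_coeff (\<Sum>i\<le>degree f. Polynomial.smult (Polynomial.coeff f i) (?g i))
        = Polynomial.coeff f (degree f) * lead_coeff (?g (degree f))"
      using that f by (intro lead_coeff_sum_increasing_degree) (simp_all add: strict_mono_Suc_iff)
    then show False using rel f that(1)[of "degree f"] by simp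
  qed
  have 1: "degree b \<le> 1"
  proof (rule ccontr)
    assume "\<not> degree b \<le> 1"
    then show False
      using degree_growth[of 0 ?g "[:0, 1:]" b ?q] b0 q by (intro no_growth) simp_all
  qed
  have 2: "degree ([:0, 1:] + b) = 0" if "?q > 2"
  proof (rule ccontr)
    assume pos: "degree ([:0, 1:] + b) \<noteq> 0"
    define m where "m = degree ([:0, 1:] + b)"
    have g1: "?g (Suc 0) = [:0, 1:] + b" by simp
    have "3 * m \<le> ?q * m" using that by (intro mult_right_mono) simp_all
    moreover have "m > 0" using pos by (simp add: m_def)
    ultimately have dom: "1 + m < degree b + ?q * m" by linarith
    have nz: "?g (Suc 0) \<noteq> 0" using pos by (metis g1 degree_0)
    have rec: "?g (Suc n) = [:0, 1:] * ?g n + b * ?g n ^ ?q" for n by simp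
    note growth = degree_growth[of "Suc 0" ?g "[:0, 1:]" b ?q, OF rec _ b0 nz]
    have late: "?g (Suc n) \<noteq> 0" "degree (?g (Suc n)) < degree (?g (Suc (Suc n)))" for n
      using growth(1,2)[of "Suc n"] q dom unfolding g1 m_def by (simp_all del: twisted_orbit.simps)
    show False
    proof (rule no_growth)
      fix n
      show "?g n \<noteq> 0" using late(1) by (cases n) (simp_all del: twisted_orbit.simps(2))
      show "degree (?g n) < degree (?g (Suc n))"
      proof (cases n)
        case 0
        then show ?thesis using pos by simp
      next
        case (Suc k)
        then show ?thesis using late(2) by blast
      qed
    qed
  qed
  show thesis using that[OF b 1 2] by blast
qed

lemma zero_mem_torsion:
  assumes "drinfeld_module_rank1 \<phi>"
  shows "0 \<in> torsion \<phi>"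
  unfolding torsion_def using drinfeld_zero(2)[OF assms] by (auto intro: exI[of _ 1])

lemma torsion_imp_T_plus_constant:
  fixes \<phi> :: "'a::{field,finite} poly \<Rightarrow> _"
  assumes D: "drinfeld_module_rank1 \<phi>" and T: "\<phi> [:0, 1:] = T_poly a" and q: "CARD('a) > 2"
    and \<alpha>: "\<alpha> \<in> torsion \<phi>" "\<alpha> \<noteq> 0"
  obtains c where "a * \<alpha> ^ (CARD('a) - 1) = - (T_K + Fq_to_K c)"
proof -
  obtain b where b: "a * \<alpha> ^ (CARD('a) - 1) = to_fract b" "degree ([:0, 1:] + b) = 0"
    using torsion_coefficient[OF D T \<alpha>] q by blast
  obtain k where k: "[:0, 1:] + b = [:k:]" using b(2) degree_eq_zeroE by blast
  have "b = [:k:] - [:0, 1:]" by (simp flip: k)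
  then have "b = - ([:0, 1:] + [:- k:])" by simp
  then have "a * \<alpha> ^ (CARD('a) - 1) = - (T_K + Fq_to_K (- k))"
    unfolding b(1) K_embeddings by (simp only: to_fract_uminus to_fract_add)
  then show thesis by (rule that)
qed

section \<open>Isomorphisms by rescaling\<close>

text \<open>
  Isomorphisms are conjugations by \<open>x \<mapsto> u x\<close>, so every \<open>u \<noteq> 0\<close> can be used to build
  the target module, whose leading coefficient is \<open>a u\<^sup>q / u\<close>.
\<close>
lemma drinfeld_twist:
  fixes \<phi> :: "'a::{field,finite} poly \<Rightarrow> _"
  assumes D: "drinfeld_module_rank1 \<phi>" and T: "\<phi> [:0, 1:] = T_poly a" and u: "u \<noteq> 0"
  obtains \<psi> where "drinfeld_module_rank1 \<psi>" "\<psi> [:0, 1:] = T_poly (a * u ^ (CARD('a) - 1))"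
    "drinfeld_isomorphic \<phi> \<psi>"
proof -
  let ?u = "Polynomial.monom u 1"
  define \<psi> where "\<psi> f = Polynomial.smult (inverse u) (pcompose (\<phi> f) ?u)" for f
  note phi = D[unfolded drinfeld_module_rank1_def]
  have coeff: "Polynomial.coeff (\<psi> f) n = inverse u * (u ^ n * Polynomial.coeff (\<phi> f) n)" for f n
    by (simp add: \<psi>_def)
  have conj: "pcompose (\<phi> f) ?u = Polynomial.smult u (\<psi> f)" for f
    using u by (simp add: \<psi>_def)
  have scale: "pcompose ?u p = Polynomial.smult u p" for p
    by (simp add: monom_altdef pcompose_smult pcompose_pCons)
  have comp: "\<psi> (f * g) = pcompose (\<psi> f) (\<psi> g)" for f g
  proof -
    have "pcompose (\<phi> (f * g)) ?u = pcompose (\<phi> f) (pcompose (\<phi> g) ?u)"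
      using phi by (simp add: pcompose_assoc)
    also have "\<dots> = pcompose (pcompose (\<phi> f) ?u) (\<psi> g)"
      by (simp only: conj[of g] scale[symmetric] pcompose_assoc)
    also have "\<dots> = Polynomial.smult u (pcompose (\<psi> f) (\<psi> g))"
      by (simp only: conj[of f] pcompose_smult)
    finally show ?thesis using u by (simp add: \<psi>_def)
  qed
  have q: "1 < CARD('a)" by (rule one_less_CARD_field)
  have psi_T: "\<psi> [:0, 1:] = T_poly (a * u ^ (CARD('a) - 1))"
  proof (rule poly_eqI)
    fix n
    have "inverse u * u ^ CARD('a) = u ^ (CARD('a) - 1)"
      using u by (simp add: power_eq_if)
    then show "Polynomial.coeff (\<psi> [:0, 1:]) n
        = Polynomial.coeff (T_poly (a * u ^ (CARD('a) - 1))) n"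
      using u q by (auto simp: coeff T T_poly_def)
  qed
  have "drinfeld_module_rank1 \<psi>"
    unfolding drinfeld_module_rank1_def
  proof (intro conjI allI)
    show "Fq_linear_poly (\<psi> f)" for f
      using phi by (auto simp: Fq_linear_poly_def coeff)
    show "\<psi> (f + g) = \<psi> f + \<psi> g" for f g
      using phi by (simp add: \<psi>_def pcompose_add smult_add_right)
    show "\<psi> (f * g) = pcompose (\<psi> f) (\<psi> g)" for f g by (rule comp)
    show "\<psi> [:c:] = Polynomial.monom (Fq_to_K c) 1" for c
      using phi u by (intro poly_eqI) (auto simp: coeff)
    show "\<exists>a1. a1 \<noteq> 0 \<and> \<psi> [:0, 1:] = T_poly a1"
      using psi_T drinfeld_coefficient_nonzero[OF D T] u
      by (intro exI[of _ "a * u ^ (CARD('a) - 1)"]) simp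
  qed
  moreover have "drinfeld_isomorphic \<phi> \<psi>"
    using u conj unfolding drinfeld_isomorphic_def by blast
  ultimately show thesis using that psi_T by blast
qed

section \<open>Torsion for q > 2\<close>

lemma order_power:
  fixes p :: "'b::idom poly"
  assumes "p \<noteq> 0"
  shows "Polynomial.order c (p ^ n) = n * Polynomial.order c p"
  using assms by (induction n) (simp_all add: order_mult)

text \<open>
  If \<open>c \<noteq> d\<close>, then \<open>(T + d)/(T + c)\<close> vanishes to order exactly \<open>1\<close> at \<open>-d\<close>, whereas the order of an \<open>n\<close>-th
  power is a multiple of \<open>n\<close>.
\<close>
lemma T_plus_constant_power_multiple:
  fixes \<alpha> :: "'a::field poly fract"
  assumes n: "n > 1" and eq: "(T_K + Fq_to_K c) * \<alpha> ^ n = T_K + Fq_to_K d"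
  shows "c = d"
proof (rule ccontr)
  assume "c \<noteq> d"
  obtain p s where \<alpha>: "\<alpha> = to_fract p / to_fract s" and s: "s \<noteq> 0"
    by (cases \<alpha>) (auto simp: Fract_conv_to_fract)
  have "to_fract ([:c, 1:] * p ^ n) = to_fract ([:d, 1:] * s ^ n)"
  proof -
    have linear: "T_K + Fq_to_K k = to_fract [:k, 1:]" for k :: 'a
      by (simp add: K_embeddings flip: to_fract_add)
    show ?thesis
      using eq s unfolding linear \<alpha> to_fract_mult to_fract_power
      by (simp add: power_divide divide_eq_eq)
  qed
  then have poly_eq: "[:c, 1:] * p ^ n = [:d, 1:] * s ^ n" by (simp only: to_fract_eq_iff)
  moreover have "[:d, 1:] * s ^ n \<noteq> 0" using s by (simp del: mult_pCons_left)
  ultimately have p: "p \<noteq> 0" using n by (auto simp: power_0_left)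
  have "Polynomial.order (- d) [:c, 1:] = 0" using \<open>c \<noteq> d\<close> by (intro order_0I) simp
  moreover have "Polynomial.order (- d) [:d, 1:] = 1"
    using order_power_n_n[of "- d" 1] by simp
  ultimately have "n * Polynomial.order (- d) p = 1 + n * Polynomial.order (- d) s"
    using arg_cong[OF poly_eq, of "Polynomial.order (- d)"] p s
    by (simp add: order_mult order_power del: mult_pCons_left)
  then have "n dvd 1" by (metis dvd_add_left_iff dvd_triv_left)
  then show False using n by simp
qed

text \<open>
  On \<open>F\<^sub>q\<close> the \<open>q\<close>-th power map is the identity, hence \<open>\<phi>\<^sub>T\<close> acts as \<open>T - (T + c) = -c\<close>.
\<close>
lemma action_on_constant:
  fixes \<phi> :: "'a::{field,finite} poly \<Rightarrow> _"
  assumes D: "drinfeld_module_rank1 \<phi>" and T: "\<phi> [:0, 1:] = T_poly (- (T_K + Fq_to_K c))"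
  shows "poly (\<phi> f) (Fq_to_K d) = Fq_to_K (poly f (- c) * d)"
proof (induction f)
  case 0
  then show ?case by (simp add: drinfeld_zero[OF D] K_embeddings)
next
  case (pCons e f)
  let ?k = "poly f (- c) * d"
  have power: "to_fract [:?k:] ^ CARD('a) = to_fract [:?k:]"
    by (simp add: poly_const_pow power_CARD_eq_self flip: to_fract_power)
  have "poly (\<phi> (pCons e f)) (Fq_to_K d) = to_fract ([:e:] * [:d:] + ([:0, 1:] * [:?k:]
      + (- ([:0, 1:] + [:c:])) * [:?k:]))"
    by (simp only: drinfeld_action_pCons[OF D T] pCons[unfolded K_embeddings] K_embeddings power
        to_fract_add to_fract_mult to_fract_uminus)
  also have "[:e:] * [:d:] + ([:0, 1:] * [:?k:] + (- ([:0, 1:] + [:c:])) * [:?k:])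
      = [:poly (pCons e f) (- c) * d:]"
    by (simp add: algebra_simps)
  finally show ?case by (simp add: K_embeddings)
qed

lemma torsion_T_plus_constant:
  fixes \<phi> :: "'a::{field,finite} poly \<Rightarrow> _"
  assumes D: "drinfeld_module_rank1 \<phi>" and T: "\<phi> [:0, 1:] = T_poly (- (T_K + Fq_to_K c))"
    and q: "CARD('a) > 2"
  shows "torsion \<phi> = range Fq_to_K"
proof
  have "poly (\<phi> [:c, 1:]) (Fq_to_K d) = 0" for d
    unfolding action_on_constant[OF D T] by (simp add: K_embeddings)
  then show "range Fq_to_K \<subseteq> torsion \<phi>"
    by (auto simp: torsion_def intro!: exI[of _ "[:c, 1:]"])
  show "torsion \<phi> \<subseteq> range Fq_to_K"
  proof
    fix \<alpha> assume \<alpha>: "\<alpha> \<in> torsion \<phi>"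
    show "\<alpha> \<in> range Fq_to_K"
    proof (rule fixed_by_power_CARD, cases "\<alpha> = 0")
      case False
      obtain d where d: "- (T_K + Fq_to_K c) * \<alpha> ^ (CARD('a) - 1) = - (T_K + Fq_to_K d)"
        using torsion_imp_T_plus_constant[OF D T q \<alpha> False] by blast
      then have eq: "(T_K + Fq_to_K c) * \<alpha> ^ (CARD('a) - 1) = T_K + Fq_to_K d"
        by (metis minus_mult_left neg_equal_iff_equal)
      have "c = d" by (rule T_plus_constant_power_multiple[OF _ eq]) (use q in simp)
      moreover have "T_K + Fq_to_K c \<noteq> 0"
        using drinfeld_coefficient_nonzero[OF D T] by (metis neg_equal_0_iff_equal)
      ultimately have "\<alpha> ^ (CARD('a) - 1) = 1" using eq by simp
      then show "\<alpha> ^ CARD('a) = \<alpha>" by (simp add: power_eq_if)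
    qed simp
  qed
qed

section \<open>Torsion of the Carlitz module for q = 2\<close>

lemma CARD_two_field:
  assumes "CARD('a::{field,finite}) = 2"
  shows "(2::'a) = 0" "(x::'a) * x = x"
proof -
  have sq: "y * y = y" for y :: 'a
    using power_CARD_eq_self[of y] assms by (simp add: power2_eq_square)
  show "x * x = x" by (rule sq)
  have "(-1::'a) = 1" using sq[of "-1"] by simp
  then have "(1::'a) + 1 = 0" by (metis add.right_inverse)
  then show "(2::'a) = 0" by simp
qed

text \<open>
  For \<open>q = 2\<close> the operator \<open>\<psi>\<^sub>T\<close> has the eigenvectors \<open>T\<close>, with eigenvalue \<open>0\<close>, and \<open>T + 1\<close>, with
  eigenvalue \<open>1\<close>. As \<open>1 = T + (T + 1)\<close>, the value is \<open>f(0) T + f(1) (T + 1)\<close>, here sorted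
  by powers of \<open>T\<close>.
\<close>
lemma carlitz_action_on_one:
  fixes \<psi> :: "'a::{field,finite} poly \<Rightarrow> _"
  assumes C: "carlitz_module \<psi>" and q: "CARD('a) = 2"
  shows "poly (\<psi> f) 1 = Fq_to_K (poly f 1) + Fq_to_K (poly f 0 + poly f 1) * T_K"
proof (induction f)
  case 0
  then show ?case using C by (simp add: drinfeld_zero carlitz_module_def K_embeddings)
next
  case (pCons c f)
  have D: "drinfeld_module_rank1 \<psi>" and T: "\<psi> [:0, 1:] = T_poly 1"
    using C by (simp_all add: carlitz_module_def)
  let ?w = "[:poly f 1, poly f 0 + poly f 1:]"
  have w: "poly (\<psi> f) 1 = to_fract ?w"
    by (simp add: pCons K_embeddings flip: to_fract_mult to_fract_add)
  have "poly (\<psi> (pCons c f)) 1 = to_fract ([:c:] + ([:0, 1:] * ?w + ?w ^ 2))"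
    by (simp only: drinfeld_action_pCons[OF D T] w q K_embeddings
        to_fract_add to_fract_mult to_fract_power mult_1_left mult_1_right)
  also have "[:c:] + ([:0, 1:] * ?w + ?w ^ 2) = [:c + poly f 1, poly f 1:]"
    by (simp add: power2_eq_square algebra_simps CARD_two_field[OF q])
  finally show ?case
    by (simp add: K_embeddings algebra_simps CARD_two_field[OF q] flip: to_fract_mult to_fract_add)
qed

lemma torsion_carlitz:
  fixes \<psi> :: "'a::{field,finite} poly \<Rightarrow> _"
  assumes C: "carlitz_module \<psi>" and q: "CARD('a) = 2"
  shows "torsion \<psi> = range (\<lambda>f. poly (\<psi> f) 1)"
    "torsion \<psi> = {Fq_to_K a + Fq_to_K b * T_K | a b. True}"
proof -
  have D: "drinfeld_module_rank1 \<psi>" and T: "\<psi> [:0, 1:] = T_poly 1"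
    using C by (simp_all add: carlitz_module_def)
  let ?L = "{Fq_to_K a + Fq_to_K b * T_K | a b :: 'a. True}" and ?O = "range (\<lambda>f. poly (\<psi> f) 1)"
  have "torsion \<psi> \<subseteq> ?L"
  proof
    fix \<alpha> assume \<alpha>: "\<alpha> \<in> torsion \<psi>"
    have "\<exists>b. \<alpha> = to_fract b \<and> degree b \<le> 1"
    proof (cases "\<alpha> = 0")
      case True
      then show ?thesis by (intro exI[of _ 0]) simp
    next
      case False
      then show ?thesis using torsion_coefficient[OF D T \<alpha>] q by auto
    qed
    then obtain b where b: "\<alpha> = to_fract b" "degree b \<le> 1" by blast
    then have "b = [:Polynomial.coeff b 0, Polynomial.coeff b 1:]"
      by (intro poly_eqI) (auto simp: coeff_pCons coeff_eq_0 split: nat.split)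
    then have "\<alpha> = Fq_to_K (Polynomial.coeff b 0) + Fq_to_K (Polynomial.coeff b 1) * T_K"
      by (simp add: b K_embeddings flip: to_fract_mult to_fract_add)
    then show "\<alpha> \<in> ?L" by blast
  qed
  moreover have "?L \<subseteq> ?O"
  proof
    fix \<alpha> assume "\<alpha> \<in> ?L"
    then obtain a b where \<alpha>: "\<alpha> = Fq_to_K a + Fq_to_K b * T_K" by blast
    (* The line f with f(1) = a and f(0) = b - a, so that f(0) + f(1) = b. *)
    have "poly (\<psi> [:b - a, a - (b - a):]) 1 = \<alpha>"
      by (simp add: carlitz_action_on_one[OF C q] \<alpha>)
    then show "\<alpha> \<in> ?O" by blast
  qed
  moreover have "?O \<subseteq> torsion \<psi>"
  proof
    fix \<alpha> assume "\<alpha> \<in> ?O"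
    then obtain f where f: "\<alpha> = poly (\<psi> f) 1" by blast
    have "poly (\<psi> ([:0, 1, 1:] * f)) 1 = 0"
      unfolding carlitz_action_on_one[OF C q] by (simp add: K_embeddings CARD_two_field[OF q])
    then have "poly (\<psi> [:0, 1, 1:]) \<alpha> = 0"
      by (simp only: drinfeld_action_rules[OF D] f)
    then show "\<alpha> \<in> torsion \<psi>"
      unfolding torsion_def by (auto intro!: exI[of _ "[:0, 1, 1:]"])
  qed
  ultimately show "torsion \<psi> = ?O" "torsion \<psi> = ?L" by auto
qed

lemma carlitz_annihilator_of_one:
  fixes \<psi> :: "'a::{field,finite} poly \<Rightarrow> _"
  assumes C: "carlitz_module \<psi>" and q: "CARD('a) = 2"
  shows "poly (\<psi> f) 1 = 0 \<longleftrightarrow> [:0, 1:]^2 + [:0, 1:] dvd f"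
proof -
  note two = CARD_two_field[OF q]
  have "poly (\<psi> f) 1 = to_fract [:poly f 1, poly f 0 + poly f 1:]"
    by (simp add: carlitz_action_on_one[OF C q] K_embeddings flip: to_fract_mult to_fract_add)
  then have "poly (\<psi> f) 1 = 0 \<longleftrightarrow> poly f 0 = 0 \<and> poly f 1 = 0" by auto
  also have "\<dots> \<longleftrightarrow> [:0, 1:] * [:1, 1:] dvd f"
  proof
    assume roots: "poly f 0 = 0 \<and> poly f 1 = 0"
    then obtain h where h: "f = [:0, 1:] * h" by (auto simp: poly_eq_0_iff_dvd)
    then have "[:- 1, 1:] dvd h" using roots by (simp flip: poly_eq_0_iff_dvd)
    moreover have "(- 1 :: 'a) = 1" using two(1) by (simp add: minus_equation_iff)
    ultimately show "[:0, 1:] * [:1, 1:] dvd f" unfolding h by (intro mult_dvd_mono) simp_all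
  next
    assume "[:0, 1:] * [:1, 1:] dvd f"
    then show "poly f 0 = 0 \<and> poly f 1 = 0" by (auto simp: two(1) elim!: dvdE)
  qed
  also have "[:0, 1:] * [:1, 1:] = ([:0, 1:]^2 + [:0, 1:] :: 'a poly)"
    by (simp add: power2_eq_square)
  finally show ?thesis .
qed

section \<open>Cyclic torsion modules\<close>

lemma cring_A_ring: "cring A_ring"
  by (rule cringI, rule abelian_groupI)
    (auto simp: A_ring_def algebra_simps intro!: comm_monoidI exI[of _ "- x" for x])

lemma module_quotient_module:
  assumes "cring R" "ideal I R"
  shows "Module.module R (quotient_module R I)"
proof -
  interpret cring R by fact
  interpret I: ideal I R by fact
  interpret Q: ring "R Quot I" by (rule I.quotient_is_ring)
  have coset: "I +>\<^bsub>R\<^esub> a \<in> carrier (R Quot I)" if "a \<in> carrier R" for a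
    using that I.rcos_ring_hom by (auto simp: ring_hom_def)
  show ?thesis
  proof (rule moduleI)
    show "abelian_group (quotient_module R I)"
      using abelian_groupE[OF Q.abelian_group_axioms]
      by (intro abelian_groupI) (auto simp: quotient_module_def)
  qed (use \<open>cring R\<close> coset I.rcos_ring_hom in \<open>auto simp: quotient_module_def
      ring_hom_add[OF I.rcos_ring_hom] ring_hom_mult[OF I.rcos_ring_hom]
      ring_hom_one[OF I.rcos_ring_hom] Q.l_distr Q.r_distr Q.m_assoc\<close>)
qed

text \<open>
  The map \<open>f \<mapsto> \<phi>\<^sub>f(e)\<close> is a surjection of \<open>A\<close>-modules onto the torsion, with kernel generated by \<open>g\<close>.
  The inverse of the induced isomorphism is used: it sends \<open>x\<close> to its fibre, which is
  a coset of the kernel, and so avoids a choice of representatives. The module axioms for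
  the torsion are read off from the ring operations of \<open>A\<close> through the surjection.
\<close>
lemma cyclic_torsion_isomorphic_quotient:
  fixes \<phi> :: "'a::{field,finite} poly \<Rightarrow> _"
  assumes D: "drinfeld_module_rank1 \<phi>"
    and gen: "torsion \<phi> = range (\<lambda>f. poly (\<phi> f) e)"
    and ann: "\<And>f. poly (\<phi> f) e = 0 \<longleftrightarrow> g dvd f"
  shows "module_isomorphic A_ring (torsion_module \<phi>)
    (quotient_module A_ring (PIdl\<^bsub>A_ring\<^esub> g))"
proof -
  let ?I = "PIdl\<^bsub>A_ring\<^esub> g" and ?ev = "\<lambda>f. poly (\<phi> f) e"
  interpret A: cring "A_ring :: 'a poly ring" by (rule cring_A_ring)
  have ideal: "ideal ?I A_ring" by (intro A.cgenideal_ideal) (simp add: A_ring_def)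
  interpret I: ideal ?I A_ring by (rule ideal)
  note rules = drinfeld_action_rules[OF D]
  have add: "?ev f + ?ev h = ?ev (f + h)" for f h by (simp add: rules)
  have act: "poly (\<phi> r) (?ev f) = ?ev (r * f)" for r f by (simp add: rules)
  have zero: "?ev 0 = 0" by (simp add: drinfeld_zero[OF D])
  have coset: "?I +>\<^bsub>A_ring\<^esub> f = {h. ?ev h = ?ev f}" for f
  proof -
    have "?ev h = ?ev f \<longleftrightarrow> g dvd h - f" for h
    proof -
      have "?ev h = ?ev (h - f) + ?ev f" by (simp add: add)
      then show ?thesis by (simp flip: ann)
    qed
    moreover have "?I +>\<^bsub>A_ring\<^esub> f = {h. g dvd h - f}"
    proof -
      have "h \<in> ?I +>\<^bsub>A_ring\<^esub> f \<longleftrightarrow> (\<exists>r. h - f = g * r)" for h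
        by (auto simp: a_r_coset_def' cgenideal_def A_ring_def diff_eq_eq mult.commute)
      then show ?thesis by (auto simp: dvd_def)
    qed
    ultimately show ?thesis by simp
  qed
  have module: "Module.module A_ring (torsion_module \<phi>)"
  proof (rule moduleI[OF cring_A_ring])
    show "abelian_group (torsion_module \<phi>)"
    proof (rule abelian_groupI)
      show "\<zero>\<^bsub>torsion_module \<phi>\<^esub> \<in> carrier (torsion_module \<phi>)"
        using zero by (simp add: torsion_module_def drinfeld_action_def gen)
      fix x assume "x \<in> carrier (torsion_module \<phi>)"
      then obtain f where x: "x = ?ev f" by (auto simp: torsion_module_def gen)
      have "?ev (- f) + x = 0" using zero by (simp add: x add)
      then show "\<exists>y\<in>carrier (torsion_module \<phi>). y \<oplus>\<^bsub>torsion_module \<phi>\<^esub> x = \<zero>\<^bsub>torsion_module \<phi>\<^esub>"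
        by (auto simp: torsion_module_def drinfeld_action_def gen)
    qed (auto simp: torsion_module_def drinfeld_action_def gen add add_ac)
  qed (auto simp: torsion_module_def drinfeld_action_def A_ring_def gen add act
      distrib_left distrib_right mult.assoc)
  define h where "h x = {f. ?ev f = x}" for x
  have h_ev: "h (?ev f) = ?I +>\<^bsub>A_ring\<^esub> f" for f by (simp add: h_def coset)
  have coset_add: "?I +>\<^bsub>A_ring\<^esub> (f + k)
      = (?I +>\<^bsub>A_ring\<^esub> f) \<oplus>\<^bsub>A_ring Quot ?I\<^esub> (?I +>\<^bsub>A_ring\<^esub> k)" for f k
    using ring_hom_add[OF I.rcos_ring_hom, of f k] by (simp add: A_ring_def)
  have coset_mult: "?I +>\<^bsub>A_ring\<^esub> (f * k)
      = (?I +>\<^bsub>A_ring\<^esub> f) \<otimes>\<^bsub>A_ring Quot ?I\<^esub> (?I +>\<^bsub>A_ring\<^esub> k)" for f k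
    using ring_hom_mult[OF I.rcos_ring_hom, of f k] by (simp add: A_ring_def)
  have carrier: "carrier (A_ring Quot ?I) = range (\<lambda>f. ?I +>\<^bsub>A_ring\<^esub> f)"
    by (auto simp: FactRing_def A_RCOSETS_def' A_ring_def)
  have "bij_betw h (torsion \<phi>) (carrier (A_ring Quot ?I))"
    unfolding bij_betw_def
  proof
    show "inj_on h (torsion \<phi>)" by (auto simp: inj_on_def gen h_def)
    show "h ` torsion \<phi> = carrier (A_ring Quot ?I)" by (simp add: gen carrier image_image h_ev)
  qed
  moreover have "h (x + y) = h x \<oplus>\<^bsub>A_ring Quot ?I\<^esub> h y" if "x \<in> torsion \<phi>" "y \<in> torsion \<phi>" for x y
    using that by (auto simp: gen add h_ev coset_add)
  moreover have "h (poly (\<phi> r) x) = (?I +>\<^bsub>A_ring\<^esub> r) \<otimes>\<^bsub>A_ring Quot ?I\<^esub> h x" if "x \<in> torsion \<phi>" for r x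
    using that by (auto simp: gen act h_ev coset_mult)
  ultimately show ?thesis
    unfolding module_isomorphic_def
    using module module_quotient_module[OF cring_A_ring ideal]
    by (auto simp: torsion_module_def drinfeld_action_def quotient_module_def intro!: exI[of _ h])
qed

section \<open>The classification\<close>

theorem theorem9:
  fixes \<phi> :: "'a::{field,finite} poly \<Rightarrow> 'a poly fract poly"
  assumes "drinfeld_module_rank1 \<phi>"
  shows
    "(CARD('a) = 2 \<longrightarrow>
        (\<exists>\<psi>. carlitz_module \<psi> \<and> drinfeld_isomorphic \<phi> \<psi>) \<and>
        (\<forall>\<psi> :: 'a poly \<Rightarrow> 'a poly fract poly. carlitz_module \<psi> \<longrightarrow>
           torsion \<psi> = {Fq_to_K a + Fq_to_K b * T_K | a b. True} \<and>
           module_isomorphic A_ring (torsion_module \<psi>)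
             (quotient_module A_ring (PIdl\<^bsub>A_ring\<^esub> ([:0, 1:]^2 + [:0, 1:])))))
     \<and>
     (CARD('a) > 2 \<longrightarrow>
        (\<forall>c. \<phi> [:0, 1:] = T_poly (- (T_K + Fq_to_K c)) \<longrightarrow>
           torsion \<phi> = range Fq_to_K \<and>
           module_isomorphic A_ring (torsion_module \<phi>)
             (quotient_module A_ring (PIdl\<^bsub>A_ring\<^esub> ([:0, 1:] + [:c:])))) \<and>
        ((\<nexists>c \<psi>. drinfeld_module_rank1 \<psi> \<and> \<psi> [:0, 1:] = T_poly (- (T_K + Fq_to_K c)) \<and>
                 drinfeld_isomorphic \<phi> \<psi>) \<longrightarrow>
           torsion \<phi> = {0}))"
proof (intro conjI impI allI)
  obtain a where T: "\<phi> [:0, 1:] = T_poly a"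
    using assms unfolding drinfeld_module_rank1_def by blast
  have a: "a \<noteq> 0" by (rule drinfeld_coefficient_nonzero[OF assms T])
  show "\<exists>\<psi>. carlitz_module \<psi> \<and> drinfeld_isomorphic \<phi> \<psi>" if "CARD('a) = 2"
  proof -
    have "inverse a \<noteq> 0" using a by simp
    then obtain \<psi> where "drinfeld_module_rank1 \<psi>" "drinfeld_isomorphic \<phi> \<psi>"
      "\<psi> [:0, 1:] = T_poly (a * inverse a ^ (CARD('a) - 1))"
      using drinfeld_twist[OF assms T] by metis
    then show ?thesis using that a by (auto simp: carlitz_module_def)
  qed
  show "torsion \<psi> = {Fq_to_K a + Fq_to_K b * T_K | a b. True}"
    if "CARD('a) = 2" "carlitz_module \<psi>" for \<psi> :: "'a poly \<Rightarrow> 'a poly fract poly"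
    using torsion_carlitz(2) that by blast
  show "module_isomorphic A_ring (torsion_module \<psi>)
      (quotient_module A_ring (PIdl\<^bsub>A_ring\<^esub> ([:0, 1:]^2 + [:0, 1:])))"
    if "CARD('a) = 2" "carlitz_module \<psi>" for \<psi> :: "'a poly \<Rightarrow> 'a poly fract poly"
    using that torsion_carlitz(1) carlitz_annihilator_of_one
    by (intro cyclic_torsion_isomorphic_quotient[where e = 1]) (auto simp: carlitz_module_def)
  fix c
  show "torsion \<phi> = range Fq_to_K"
    if "CARD('a) > 2" "\<phi> [:0, 1:] = T_poly (- (T_K + Fq_to_K c))"
    using torsion_T_plus_constant assms that by blast
  show "module_isomorphic A_ring (torsion_module \<phi>)
      (quotient_module A_ring (PIdl\<^bsub>A_ring\<^esub> ([:0, 1:] + [:c:])))"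
    if q: "CARD('a) > 2" and Tc: "\<phi> [:0, 1:] = T_poly (- (T_K + Fq_to_K c))"
  proof (rule cyclic_torsion_isomorphic_quotient[where e = "Fq_to_K 1"])
    note at_one = action_on_constant[OF assms Tc, of _ 1, simplified]
    show "poly (\<phi> f) (Fq_to_K 1) = 0 \<longleftrightarrow> [:0, 1:] + [:c:] dvd f" for f
      unfolding at_one by (simp add: K_embeddings poly_eq_0_iff_dvd)
    have "range (\<lambda>f. Fq_to_K (poly f (- c))) = range Fq_to_K"
    proof (intro equalityI subsetI)
      fix x assume "x \<in> range (Fq_to_K :: 'a \<Rightarrow> _)"
      then obtain d where "x = Fq_to_K (poly [:d:] (- c))" by auto
      then show "x \<in> range (\<lambda>f. Fq_to_K (poly f (- c)))" by blast
    qed auto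
    then show "torsion \<phi> = range (\<lambda>f. poly (\<phi> f) (Fq_to_K 1))"
      unfolding at_one using torsion_T_plus_constant[OF assms Tc q] by simp
  qed (rule assms)
next
  assume q: "CARD('a) > 2"
    and not_iso: "\<nexists>c \<psi>. drinfeld_module_rank1 \<psi> \<and> \<psi> [:0, 1:] = T_poly (- (T_K + Fq_to_K c)) \<and>
      drinfeld_isomorphic \<phi> \<psi>"
  obtain a where T: "\<phi> [:0, 1:] = T_poly a"
    using assms unfolding drinfeld_module_rank1_def by blast
  have "\<alpha> = 0" if "\<alpha> \<in> torsion \<phi>" for \<alpha>
  proof (rule ccontr)
    assume "\<alpha> \<noteq> 0"
    with torsion_imp_T_plus_constant[OF assms T q that] drinfeld_twist[OF assms T]
    show False using not_iso by metis
  qed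
  then show "torsion \<phi> = {0}" using zero_mem_torsion[OF assms] by auto
qed

end
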